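(* Let $V=\{z\in\mathbb{C}^3: z_1^2+z_2^2+z_3^2=1\}$ be the complexified sphere. The Okounkov body of $V$, computed at the point $a=(0,0,1)$ with respect to the local coordinates $(z_1,z_2)$, is the triangle $$\Delta=\{(\theta_1,\theta_2)\in\mathbb{R}^2:\ \theta_1,\theta_2\ge0,\ \theta_1+2\theta_2\le 2\}.$$
   Context: $\mathbb{C}[V]_{\le k}$ denotes the space of restrictions to $V$ of polynomials in $\mathbb{C}[z_1,z_2,z_3]$ of degree $\le k$. Near $a=(0,0,1)$, $V$ is the graph $z_3=(1-z_1^2-z_2^2)^{1/2}$ (branch with value $1$ at the origin), so $(z_1,z_2)$ are local coordinates, and each nonzero $p\in\mathbb{C}[V]$ has a power series $p=\sum_\alpha c_\alpha z_1^{\alpha_1}z_2^{\alpha_2}$ at $a$. The lexicographic order on $\mathbb{Z}_{\ge0}^2$ is: $\alpha\prec_l\beta$ if there is $j\in\{1,2\}$ with $\alpha_j<\beta_j$ and $\alpha_i=\beta_i$ for all $i>j$ (so $z_1\prec_l z_2$). $\nu(p)$ is the $\prec_l$-smallest exponent $\alpha$ with $c_\alpha\neq0$. Put $\mathcal{N}_k=\{\nu(p):0\ne p\in\mathbb{C}[V]_{\le k}\}$ and let $\Delta_k$ be the convex hull of $\frac1k\mathcal{N}_k$ in $\mathbb{R}^2$. The Okounkov body is the convex hull of $\bigcup_{k\in\mathbb{N}}\Delta_k$. *)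

theory Defs
  imports "HOL-Analysis.Analysis" "HOL-Library.Poly_Mapping"
begin

text \<open>A polynomial in \<open>\<complex>[z\<^sub>1,z\<^sub>2,z\<^sub>3]\<close> is a finitely supported map from exponents to coefficients.\<close>

type_synonym poly3 = "(nat ^ 3) \<Rightarrow>\<^sub>0 complex"

definition eval3 :: "poly3 \<Rightarrow> complex ^ 3 \<Rightarrow> complex" where
  "eval3 p z = (\<Sum>m\<in>Poly_Mapping.keys p. Poly_Mapping.lookup p m * (\<Prod>i\<in>UNIV. (z $ i) ^ (m $ i)))"

definition degree_le :: "poly3 \<Rightarrow> nat \<Rightarrow> bool" where
  "degree_le p k \<longleftrightarrow> (\<forall>m\<in>Poly_Mapping.keys p. (\<Sum>i\<in>UNIV. m $ i) \<le> k)"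

text \<open>Restrictions are extensional functions, so that two polynomials give the same element
  exactly when they agree on \<open>V\<close>.\<close>

definition coord_ring_le :: "(complex ^ 3) set \<Rightarrow> nat \<Rightarrow> (complex ^ 3 \<Rightarrow> complex) set" where
  "coord_ring_le V k = {restrict (eval3 p) V | p. degree_le p k}"

text \<open>The second coordinate is compared first. This is spelled out because the order of the
  numeral type \<open>2\<close> is not the expected one: there \<open>2 = 0 < 1\<close>.\<close>

definition lex_less :: "nat ^ 2 \<Rightarrow> nat ^ 2 \<Rightarrow> bool" where
  "lex_less \<alpha> \<beta> \<longleftrightarrow> \<alpha> $ 2 < \<beta> $ 2 \<or> (\<alpha> $ 2 = \<beta> $ 2 \<and> \<alpha> $ 1 < \<beta> $ 1)"

text \<open>\<open>f = \<Sum>\<^sub>\<alpha> c\<^sub>\<alpha> x\<^sub>1\<^bsup>\<alpha>\<^sub>1\<^esup> x\<^sub>2\<^bsup>\<alpha>\<^sub>2\<^esup>\<close> on a neighbourhood of \<open>a\<close> in \<open>V\<close>, where \<open>x = (x\<^sub>1, x\<^sub>2)\<close> are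
  local coordinates on \<open>V\<close> vanishing at \<open>a\<close>.\<close>

definition has_power_series_at ::
    "(complex ^ 3) set \<Rightarrow> complex ^ 3 \<Rightarrow> (complex ^ 3 \<Rightarrow> complex ^ 2) \<Rightarrow>
     (complex ^ 3 \<Rightarrow> complex) \<Rightarrow> (nat ^ 2 \<Rightarrow> complex) \<Rightarrow> bool" where
  "has_power_series_at V a x f c \<longleftrightarrow>
     (\<exists>e>0. \<forall>z\<in>V \<inter> ball a e.
        ((\<lambda>\<alpha>. c \<alpha> * (x z $ 1) ^ (\<alpha> $ 1) * (x z $ 2) ^ (\<alpha> $ 2)) has_sum f z) UNIV)"

definition valuation ::
    "(complex ^ 3) set \<Rightarrow> complex ^ 3 \<Rightarrow> (complex ^ 3 \<Rightarrow> complex ^ 2) \<Rightarrow>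
     (complex ^ 3 \<Rightarrow> complex) \<Rightarrow> nat ^ 2" where
  "valuation V a x f =
     (THE \<alpha>. \<exists>c. has_power_series_at V a x f c \<and> c \<alpha> \<noteq> 0 \<and>
                 (\<forall>\<beta>. c \<beta> \<noteq> 0 \<and> \<beta> \<noteq> \<alpha> \<longrightarrow> lex_less \<alpha> \<beta>))"

definition valuation_set ::
    "(complex ^ 3) set \<Rightarrow> complex ^ 3 \<Rightarrow> (complex ^ 3 \<Rightarrow> complex ^ 2) \<Rightarrow> nat \<Rightarrow> (nat ^ 2) set" where
  "valuation_set V a x k = valuation V a x ` (coord_ring_le V k - {restrict (\<lambda>_. 0) V})"

definition Delta ::
    "(complex ^ 3) set \<Rightarrow> complex ^ 3 \<Rightarrow> (complex ^ 3 \<Rightarrow> complex ^ 2) \<Rightarrow> nat \<Rightarrow> (real ^ 2) set" where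
  "Delta V a x k =
     convex hull ((\<lambda>\<alpha>. (1 / real k) *\<^sub>R (\<chi> i. real (\<alpha> $ i))) ` valuation_set V a x k)"

definition okounkov_body ::
    "(complex ^ 3) set \<Rightarrow> complex ^ 3 \<Rightarrow> (complex ^ 3 \<Rightarrow> complex ^ 2) \<Rightarrow> (real ^ 2) set" where
  "okounkov_body V a x = convex hull (\<Union>k\<in>{1..}. Delta V a x k)"

definition complex_sphere :: "(complex ^ 3) set" where
  "complex_sphere = {z. (z $ 1)\<^sup>2 + (z $ 2)\<^sup>2 + (z $ 3)\<^sup>2 = 1}"

text \<open>Near \<open>(0,0,1)\<close> the sphere is the graph of the branch of \<open>(1 - z\<^sub>1\<^sup>2 - z\<^sub>2\<^sup>2)\<^bsup>1/2\<^esup>\<close> with value \<open>1\<close>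
  at the origin, so \<open>(z\<^sub>1, z\<^sub>2)\<close> are local coordinates there.\<close>

lemma complex_sphere_graph:
  assumes "z \<in> ball (vector [0, 0, 1]) 1"
  shows "z \<in> complex_sphere \<longleftrightarrow> z $ 3 = csqrt (1 - (z $ 1)\<^sup>2 - (z $ 2)\<^sup>2)"
proof
  have "dist (z $ 3) 1 < 1"
    using assms dist_vec_nth_le[of "z" 3 "vector [0, 0, 1]"]
    by (simp add: dist_commute)
  hence re: "Re (z $ 3) > 0"
    using abs_Re_le_cmod[of "z $ 3 - 1"] by (simp add: dist_norm)
  assume "z \<in> complex_sphere"
  hence "(z $ 3)\<^sup>2 = 1 - (z $ 1)\<^sup>2 - (z $ 2)\<^sup>2"
    by (simp add: complex_sphere_def algebra_simps)
  thus "z $ 3 = csqrt (1 - (z $ 1)\<^sup>2 - (z $ 2)\<^sup>2)"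
    using csqrt_unique[of "z $ 3"] re by simp
next
  assume "z $ 3 = csqrt (1 - (z $ 1)\<^sup>2 - (z $ 2)\<^sup>2)"
  hence "(z $ 3)\<^sup>2 = 1 - (z $ 1)\<^sup>2 - (z $ 2)\<^sup>2"
    by (metis power2_csqrt)
  thus "z \<in> complex_sphere"
    by (simp add: complex_sphere_def)
qed

end

theory Submission
  imports Defs
begin

text \<open>
  In the coordinates \<open>(z\<^sub>1, z\<^sub>2)\<close> a polynomial function on the sphere has at the point \<open>(0, 0, 1)\<close> an
  expansion \<open>F\<close> in \<open>\<complex>[[X]][[Y]]\<close>, which is represented as a power series in \<open>Y\<close> over the ring
  \<^typ>\<open>complex fps\<close>. Because the exponent of \<open>z\<^sub>2\<close> is compared first, the valuation is the pair
  consisting of the \<open>X\<close>-order of the lowest nonzero coefficient of \<open>F\<close>, and the \<open>Y\<close>-order of \<open>F\<close>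
  (\<open>valuation_eq_subdegrees\<close>). Expanding is compatible with sums and products and determines \<open>F\<close>
  uniquely, so the valuation can be computed algebraically.

  The heart of the matter is the inequality \<open>\<alpha>\<^sub>1 + 2 \<alpha>\<^sub>2 \<le> 2 k\<close> for a nonzero function \<open>f\<close> of
  degree at most \<open>k\<close> (\<open>polyfun_lt_order_bound\<close>). Geometrically, the curve \<open>z\<^sub>2 = 0\<close> on the sphere is a
  conic, so a function of degree \<open>k\<close> that does not vanish on it has at the point a zero of order
  at most \<open>2 k\<close>; a function that vanishes on it is \<open>z\<^sub>2\<close> times a function of degree \<open>k - 1\<close>, and each such
  division lowers \<open>\<alpha>\<^sub>2\<close> by \<open>1\<close> and the bound by \<open>2\<close>. To make this algebraic, the equation of the
  sphere is used to write \<open>f = A(z\<^sub>1) + z\<^sub>3 B(z\<^sub>1) + z\<^sub>2 g\<close> (\<open>polyfun_lt_sphere_decomp\<close>). With \<open>s\<close> for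
  the expansion of \<open>z\<^sub>3\<close> on the conic, so that \<open>s\<^sup>2 = 1 - X\<^sup>2\<close>, the restriction of \<open>f\<close> is \<open>A + s B\<close>, and
  its norm \<open>(A + s B)(A - s B) = A\<^sup>2 - (1 - X\<^sup>2) B\<^sup>2\<close> is a polynomial of degree at most \<open>2 k\<close>, which
  is nonzero unless \<open>A = B = 0\<close> (\<open>conic_order_bound\<close>).

  Hence every \<open>\<Delta>\<^sub>k\<close> lies in the triangle. Its vertices \<open>(0, 0)\<close>, \<open>(0, 1)\<close> and \<open>(2, 0)\<close> are the
  valuations of \<open>1\<close>, \<open>z\<^sub>2\<close> and \<open>1 - z\<^sub>3\<close>, the last because the tangent plane \<open>z\<^sub>3 = 1\<close> meets the conic
  with multiplicity two. So \<open>\<Delta>\<^sub>1\<close> is already the whole triangle.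
\<close>

section \<open>Expansions of functions of two complex variables\<close>

unbundle no vec_syntax
unbundle fps_syntax

text \<open>The outer variable of the double series stands for the second argument, so that the
  subdegree of \<open>F\<close> is the lowest exponent of the variable that the lexicographic order compares
  first.\<close>
definition has_expansion2 ::
    "(complex \<Rightarrow> complex \<Rightarrow> complex) \<Rightarrow> complex fps fps \<Rightarrow> bool" where
  "has_expansion2 \<phi> F \<longleftrightarrow>
     (\<exists>\<delta>>0. \<forall>x y. norm x < \<delta> \<longrightarrow> norm y < \<delta> \<longrightarrow>
        ((\<lambda>(j, i). F $ j $ i * x ^ i * y ^ j) has_sum \<phi> x y) UNIV)"

lemma has_expansion2I:
  assumes "\<delta> > 0"
    and "\<And>x y. norm x < \<delta> \<Longrightarrow> norm y < \<delta> \<Longrightarrow>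
           ((\<lambda>(j, i). F $ j $ i * x ^ i * y ^ j) has_sum \<phi> x y) UNIV"
  shows "has_expansion2 \<phi> F"
  using assms unfolding has_expansion2_def by blast

lemma has_expansion2_common:
  assumes "has_expansion2 \<phi> F" "has_expansion2 \<psi> G"
  obtains \<delta> where "\<delta> > 0"
    "\<And>x y. norm x < \<delta> \<Longrightarrow> norm y < \<delta> \<Longrightarrow>
       ((\<lambda>(j, i). F $ j $ i * x ^ i * y ^ j) has_sum \<phi> x y) UNIV"
    "\<And>x y. norm x < \<delta> \<Longrightarrow> norm y < \<delta> \<Longrightarrow>
       ((\<lambda>(j, i). G $ j $ i * x ^ i * y ^ j) has_sum \<psi> x y) UNIV"
proof -
  obtain d e where d: "d > 0" "e > 0"
    and F: "\<forall>x y. norm x < d \<longrightarrow> norm y < d \<longrightarrow>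
              ((\<lambda>(j, i). F $ j $ i * x ^ i * y ^ j) has_sum \<phi> x y) UNIV"
    and G: "\<forall>x y. norm x < e \<longrightarrow> norm y < e \<longrightarrow>
              ((\<lambda>(j, i). G $ j $ i * x ^ i * y ^ j) has_sum \<psi> x y) UNIV"
    using assms unfolding has_expansion2_def by blast
  show ?thesis
    by (rule that[of "min d e"]) (use d F G in auto)
qed

lemma has_expansion2_const: "has_expansion2 (\<lambda>_ _. c) (fps_const (fps_const c))"
proof (rule has_expansion2I[of 1])
  fix x y :: complex
  show "((\<lambda>(j, i). fps_const (fps_const c) $ j $ i * x ^ i * y ^ j) has_sum c) UNIV"
    by (rule has_sum_finite_neutralI[of "{(0, 0)}"]) (auto split: if_splits)
qed simp

lemma has_expansion2_fst: "has_expansion2 (\<lambda>x _. x) (fps_const fps_X)"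
proof (rule has_expansion2I[of 1])
  fix x y :: complex
  show "((\<lambda>(j, i). fps_const fps_X $ j $ i * x ^ i * y ^ j) has_sum x) UNIV"
    by (rule has_sum_finite_neutralI[of "{(0, 1)}"]) (auto split: if_splits)
qed simp

lemma has_expansion2_snd: "has_expansion2 (\<lambda>_ y. y) fps_X"
proof (rule has_expansion2I[of 1])
  fix x y :: complex
  show "((\<lambda>(j, i). fps_X $ j $ i * x ^ i * y ^ j) has_sum y) UNIV"
    by (rule has_sum_finite_neutralI[of "{(1, 0)}"]) (auto split: if_splits)
qed simp

lemma has_expansion2_add:
  assumes "has_expansion2 \<phi> F" "has_expansion2 \<psi> G"
  shows "has_expansion2 (\<lambda>x y. \<phi> x y + \<psi> x y) (F + G)"
proof -
  obtain \<delta> where \<delta>: "\<delta> > 0"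
    "\<And>x y. norm x < \<delta> \<Longrightarrow> norm y < \<delta> \<Longrightarrow>
       ((\<lambda>(j, i). F $ j $ i * x ^ i * y ^ j) has_sum \<phi> x y) UNIV"
    "\<And>x y. norm x < \<delta> \<Longrightarrow> norm y < \<delta> \<Longrightarrow>
       ((\<lambda>(j, i). G $ j $ i * x ^ i * y ^ j) has_sum \<psi> x y) UNIV"
    using has_expansion2_common[OF assms] by blast
  show ?thesis
  proof (rule has_expansion2I[OF \<delta>(1)])
    fix x y :: complex assume "norm x < \<delta>" "norm y < \<delta>"
    from has_sum_add[OF \<delta>(2)[OF this] \<delta>(3)[OF this]]
    show "((\<lambda>(j, i). (F + G) $ j $ i * x ^ i * y ^ j) has_sum (\<phi> x y + \<psi> x y)) UNIV"
      by (simp add: case_prod_unfold algebra_simps)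
  qed
qed

text \<open>Unconditional summability is absolute in the complex numbers, which makes the family of all
  products summable.\<close>
lemma has_sum_mult_complex:
  fixes f :: "'a \<Rightarrow> complex" and g :: "'b \<Rightarrow> complex"
  assumes f: "(f has_sum S) A" and g: "(g has_sum T) B"
  shows "((\<lambda>(a, b). f a * g b) has_sum (S * T)) (A \<times> B)"
proof (rule has_sum_SigmaI)
  show "((\<lambda>b. case (a, b) of (a, b) \<Rightarrow> f a * g b) has_sum (f a * T)) B" for a
    using has_sum_cmult_right[OF g, of "f a"] by simp
  show "((\<lambda>a. f a * T) has_sum (S * T)) A"
    by (rule has_sum_cmult_left[OF f])
  have absf: "(\<lambda>a. norm (f a)) summable_on A" and absg: "(\<lambda>b. norm (g b)) summable_on B"
    using f g summable_on_iff_abs_summable_on_complex by (auto simp: summable_on_def)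
  have "(\<lambda>p. norm (case p of (a, b) \<Rightarrow> f a * g b)) summable_on A \<times> B"
  proof (rule summable_on_SigmaI)
    show "((\<lambda>b. norm (case (a, b) of (a, b) \<Rightarrow> f a * g b)) has_sum
            (norm (f a) * (\<Sum>\<^sub>\<infinity>b\<in>B. norm (g b)))) B" for a
      using has_sum_cmult_right[OF has_sum_infsum[OF absg], of "norm (f a)"]
      by (simp add: norm_mult)
    show "(\<lambda>a. norm (f a) * (\<Sum>\<^sub>\<infinity>b\<in>B. norm (g b))) summable_on A"
      by (rule summable_on_cmult_left[OF absf])
  qed simp
  thus "(\<lambda>(a, b). f a * g b) summable_on A \<times> B"
    by (rule abs_summable_summable)
qed

text \<open>The Cauchy product, taken in both variables at once: the products of terms are grouped by their
  total exponents, and each group is finite.\<close>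
lemma has_expansion2_mult:
  assumes "has_expansion2 \<phi> F" "has_expansion2 \<psi> G"
  shows "has_expansion2 (\<lambda>x y. \<phi> x y * \<psi> x y) (F * G)"
proof -
  obtain \<delta> where \<delta>: "\<delta> > 0"
    "\<And>x y. norm x < \<delta> \<Longrightarrow> norm y < \<delta> \<Longrightarrow>
       ((\<lambda>(j, i). F $ j $ i * x ^ i * y ^ j) has_sum \<phi> x y) UNIV"
    "\<And>x y. norm x < \<delta> \<Longrightarrow> norm y < \<delta> \<Longrightarrow>
       ((\<lambda>(j, i). G $ j $ i * x ^ i * y ^ j) has_sum \<psi> x y) UNIV"
    using has_expansion2_common[OF assms] by blast
  show ?thesis
  proof (rule has_expansion2I[OF \<delta>(1)])
    fix x y :: complex assume xy: "norm x < \<delta>" "norm y < \<delta>"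
    define h where "h = (\<lambda>(p :: nat \<times> nat, q :: nat \<times> nat).
      (F $ fst p $ snd p * x ^ snd p * y ^ fst p) * (G $ fst q $ snd q * x ^ snd q * y ^ fst q))"
    define T where "T = (SIGMA p : (UNIV :: (nat \<times> nat) set). {..fst p} \<times> {..snd p})"
    have "(h has_sum (\<phi> x y * \<psi> x y)) UNIV"
      using has_sum_mult_complex[OF \<delta>(2)[OF xy] \<delta>(3)[OF xy]]
      by (simp add: h_def case_prod_unfold)
    also have "?this \<longleftrightarrow> ((\<lambda>(p, q). h (q, (fst p - fst q, snd p - snd q)))
                 has_sum (\<phi> x y * \<psi> x y)) T"
      by (rule has_sum_reindex_bij_witness[of _ "\<lambda>(p, q). (q, (fst p - fst q, snd p - snd q))"
            "\<lambda>(p, q). ((fst p + fst q, snd p + snd q), p)"])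
         (auto simp: T_def)
    finally have h: "((\<lambda>(p, q). h (q, (fst p - fst q, snd p - snd q)))
                 has_sum (\<phi> x y * \<psi> x y)) T" .
    have "((\<lambda>p. \<Sum>q\<in>{..fst p} \<times> {..snd p}. h (q, (fst p - fst q, snd p - snd q)))
            has_sum (\<phi> x y * \<psi> x y)) UNIV"
      by (rule has_sum_SigmaD[OF h[unfolded T_def]]) auto
    also have "(\<lambda>p. \<Sum>q\<in>{..fst p} \<times> {..snd p}. h (q, (fst p - fst q, snd p - snd q))) =
               (\<lambda>(j, i). (F * G) $ j $ i * x ^ i * y ^ j)"
    proof (rule ext, clarify)
      fix j i :: nat
      have pw: "z ^ n = z ^ k * z ^ (n - k)" if "k \<le> n" for z :: complex and n k
        using that by (simp flip: power_add)
      have "(F * G) $ j $ i * x ^ i * y ^ j =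
            (\<Sum>b\<le>j. \<Sum>a\<le>i. F $ b $ a * G $ (j - b) $ (i - a) * x ^ i * y ^ j)"
        by (simp add: fps_mult_nth fps_sum_nth sum_distrib_right atLeast0AtMost)
      also have "\<dots> = (\<Sum>b\<le>j. \<Sum>a\<le>i. h ((b, a), (j - b, i - a)))"
        by (intro sum.cong refl) (simp add: h_def pw[of _ i x] pw[of _ j y])
      also have "\<dots> = (\<Sum>q\<in>{..j} \<times> {..i}. h (q, (j - fst q, i - snd q)))"
        by (simp add: sum.cartesian_product case_prod_unfold)
      finally show "(\<Sum>q\<in>{..fst (j, i)} \<times> {..snd (j, i)}.
          h (q, (fst (j, i) - fst q, snd (j, i) - snd q))) = (F * G) $ j $ i * x ^ i * y ^ j"
        by simp
    qed
    finally show "((\<lambda>(j, i). (F * G) $ j $ i * x ^ i * y ^ j) has_sum (\<phi> x y * \<psi> x y)) UNIV" .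
  qed
qed

text \<open>The identity theorem for power series in one variable, for unconditional sums.\<close>
lemma powser_eq_0_imp_coeffs_eq_0:
  fixes a :: "nat \<Rightarrow> complex"
  assumes \<delta>: "\<delta> > 0" and a: "\<And>x. norm x < \<delta> \<Longrightarrow> ((\<lambda>n. a n * x ^ n) has_sum 0) UNIV"
  shows "a n = 0"
proof -
  have sums: "(\<lambda>n. a n * x ^ n) sums 0" if "norm x < \<delta>" for x
    using has_sum_imp_sums[OF a[OF that]] .
  have "ereal (\<delta> / 2) \<le> fps_conv_radius (Abs_fps a)"
    using conv_radius_geI[of a "of_real (\<delta> / 2)"] sums_summable[OF sums[of "of_real (\<delta> / 2)"]] \<delta>
    by (simp add: fps_conv_radius_def)
  hence "fps_conv_radius (Abs_fps a) > 0"
    using \<delta> by (metis ereal_less(2) half_gt_zero less_le_trans)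
  moreover have "eventually (\<lambda>z. eval_fps (Abs_fps a) z = eval_fps 0 z) (nhds 0)"
  proof -
    have "eventually (\<lambda>z::complex. z \<in> ball 0 \<delta>) (nhds 0)"
      using \<delta> by (intro eventually_nhds_in_open) auto
    thus ?thesis
      by eventually_elim (use sums in \<open>auto simp: eval_fps_def sums_iff\<close>)
  qed
  ultimately have "Abs_fps a = 0"
    by (intro eval_fps_eqD) auto
  thus ?thesis by (metis fps_nth_Abs_fps fps_zero_nth)
qed

text \<open>For fixed \<open>x\<close> the double series is a power series in \<open>y\<close>, so by the identity theorem in one
  variable its coefficients, which are power series in \<open>x\<close>, all vanish; then so do theirs.\<close>
lemma has_expansion2_0_imp_eq_0:
  assumes "has_expansion2 (\<lambda>_ _. 0) F"
  shows "F = 0"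
proof -
  obtain \<delta> where \<delta>: "\<delta> > 0"
    and F: "\<And>x y. norm x < \<delta> \<Longrightarrow> norm y < \<delta> \<Longrightarrow>
              ((\<lambda>(j, i). F $ j $ i * x ^ i * y ^ j) has_sum 0) UNIV"
    using assms unfolding has_expansion2_def by blast
  have row: "((\<lambda>i. F $ j $ i * x ^ i) has_sum 0) UNIV" if x: "norm x < \<delta>" for x j
  proof -
    define g where "g j = (\<Sum>\<^sub>\<infinity>i. F $ j $ i * x ^ i)" for j
    have g: "((\<lambda>i. F $ j $ i * x ^ i) has_sum g j) UNIV" for j
    proof -
      \<comment> \<open>Any small \<open>y \<noteq> 0\<close> would do: it only serves to cancel the factor \<open>y\<^sup>j\<close>.\<close>
      define y :: complex where "y = of_real (\<delta> / 2)"
      have y: "norm y < \<delta>" "y \<noteq> 0" using \<delta> by (auto simp: y_def)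
      have "(\<lambda>(j, i). F $ j $ i * x ^ i * y ^ j) summable_on UNIV \<times> UNIV"
        using F[OF x y(1)] by (auto simp: summable_on_def)
      from summable_on_SigmaD1[OF this, of j]
      have "(\<lambda>i. F $ j $ i * x ^ i * y ^ j) summable_on UNIV" by simp
      hence "(\<lambda>i. F $ j $ i * x ^ i * y ^ j * inverse (y ^ j)) summable_on UNIV"
        by (rule summable_on_cmult_left)
      hence "(\<lambda>i. F $ j $ i * x ^ i) summable_on UNIV"
        using y by (simp add: mult.assoc)
      thus ?thesis unfolding g_def by (rule has_sum_infsum)
    qed
    have "((\<lambda>j. g j * y ^ j) has_sum 0) UNIV" if y: "norm y < \<delta>" for y
    proof (rule has_sum_SigmaD)
      show "((\<lambda>(j, i). F $ j $ i * x ^ i * y ^ j) has_sum 0) (UNIV \<times> UNIV)"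
        using F[OF x y] by simp
      show "((\<lambda>i. case (j, i) of (j, i) \<Rightarrow> F $ j $ i * x ^ i * y ^ j) has_sum g j * y ^ j) UNIV" for j
        using has_sum_cmult_left[OF g[of j], of "y ^ j"] by simp
    qed
    from powser_eq_0_imp_coeffs_eq_0[OF \<delta> this] have "g j = 0" by simp
    with g[of j] show ?thesis by simp
  qed
  have "F $ j $ i = 0" for i j
    by (rule powser_eq_0_imp_coeffs_eq_0[OF \<delta> row])
  thus ?thesis by (simp add: fps_eq_iff)
qed

lemma has_expansion2_unique:
  assumes "has_expansion2 \<phi> F" "has_expansion2 \<phi> G"
  shows "F = G"
proof -
  have "has_expansion2 (\<lambda>x y. \<phi> x y + (-1) * \<phi> x y) (F + fps_const (fps_const (-1)) * G)"
    by (intro has_expansion2_add has_expansion2_mult has_expansion2_const assms)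
  hence "F + fps_const (fps_const (-1)) * G = 0"
    by (intro has_expansion2_0_imp_eq_0) simp
  moreover have "fps_const (fps_const (-1)) * G = - G"
    by (simp add: fps_eq_iff)
  ultimately show ?thesis by simp
qed

text \<open>The binomial series of \<open>(1 - (x\<^sup>2 + y\<^sup>2))\<^bsup>1/2\<^esup>\<close>, with the powers of \<open>x\<^sup>2 + y\<^sup>2\<close> multiplied out. The
  resulting double series converges absolutely because its norms sum to the norms of the binomial
  series at \<open>|x|\<^sup>2 + |y|\<^sup>2\<close>. Existence
  of the series suffices: that its square is \<open>1 - X\<^sup>2 - Y\<^sup>2\<close> follows from uniqueness.\<close>
lemma has_expansion2_csqrt:
  "\<exists>F. has_expansion2 (\<lambda>x y. csqrt (1 - x\<^sup>2 - y\<^sup>2)) F"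
proof -
  define b :: "nat \<Rightarrow> complex" where "b n = (1 / 2 gchoose n) * (-1) ^ n" for n
  define F where "F = Abs_fps (\<lambda>j. Abs_fps (\<lambda>i. if even i \<and> even j
    then b ((i + j) div 2) * of_nat (((i + j) div 2) choose (i div 2)) else 0))"
  have "has_expansion2 (\<lambda>x y. csqrt (1 - x\<^sup>2 - y\<^sup>2)) F"
  proof (rule has_expansion2I[of "1 / 2"])
    fix x y :: complex assume xy: "norm x < 1 / 2" "norm y < 1 / 2"
    define r where "r = (norm x)\<^sup>2 + (norm y)\<^sup>2"
    have "(norm x)\<^sup>2 \<le> (1 / 2)\<^sup>2" "(norm y)\<^sup>2 \<le> (1 / 2)\<^sup>2"
      using xy by (auto intro!: power_mono)
    hence r: "0 \<le> r" "r < 3 / 4" by (auto simp: r_def power2_eq_square)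
    have "norm (x\<^sup>2 + y\<^sup>2) \<le> r"
      unfolding r_def using norm_triangle_ineq[of "x\<^sup>2" "y\<^sup>2"] by (simp add: norm_power)
    hence u: "norm (- (x\<^sup>2 + y\<^sup>2)) < 1" using r unfolding norm_minus_cancel by simp
    \<comment> \<open>The binomial series converges absolutely at \<open>r\<close> since it converges at the larger point \<open>3 / 4\<close>.\<close>
    have summ: "summable (\<lambda>n. norm ((1 / 2 gchoose n) * of_real r ^ n :: complex))"
      using powser_insidea[of "\<lambda>n. (1 / 2 gchoose n :: complex)" "of_real (3 / 4)" "of_real r"]
        sums_summable[OF gen_binomial_complex[of "of_real (3 / 4)" "1 / 2"]] r by simp
    have bu: "b n * (x\<^sup>2 + y\<^sup>2) ^ n = (1 / 2 gchoose n) * (- (x\<^sup>2 + y\<^sup>2)) ^ n" for n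
      unfolding b_def power_minus[of "x\<^sup>2 + y\<^sup>2"] by simp
    define g where "g = (\<lambda>(n, k). b n * (of_nat (n choose k) * (x\<^sup>2) ^ k * (y\<^sup>2) ^ (n - k)))"
    have norm_b: "norm (b n) = norm (1 / 2 gchoose n :: complex)" for n
      by (simp add: b_def norm_mult norm_power)
    have "(g has_sum csqrt (1 - x\<^sup>2 - y\<^sup>2)) (SIGMA n : UNIV. {..n})"
    proof (rule has_sum_SigmaI)
      show "((\<lambda>k. g (n, k)) has_sum (b n * (x\<^sup>2 + y\<^sup>2) ^ n)) {..n}" for n
        by (rule has_sum_finiteI) (simp_all add: g_def binomial_ring sum_distrib_left)
      have "summable (\<lambda>n. norm (b n * (x\<^sup>2 + y\<^sup>2) ^ n))"
        by (rule summable_comparison_test'[OF summ, of 0])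
           (use \<open>norm (x\<^sup>2 + y\<^sup>2) \<le> r\<close> r in
             \<open>auto simp: norm_mult norm_power norm_b intro!: mult_left_mono power_mono\<close>)
      moreover have "(\<lambda>n. b n * (x\<^sup>2 + y\<^sup>2) ^ n) sums csqrt (1 - x\<^sup>2 - y\<^sup>2)"
        using gen_binomial_complex[OF u, of "1 / 2"]
        by (simp add: bu csqrt_conv_powr algebra_simps)
      ultimately show "((\<lambda>n. b n * (x\<^sup>2 + y\<^sup>2) ^ n) has_sum csqrt (1 - x\<^sup>2 - y\<^sup>2)) UNIV"
        by (rule norm_summable_imp_has_sum)
      have "(\<lambda>p. norm (g p)) summable_on (SIGMA n : UNIV. {..n})"
      proof (rule summable_on_SigmaI)
        show "((\<lambda>k. norm (g (n, k))) has_sum (norm (b n) * r ^ n)) {..n}" for n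
          by (rule has_sum_finiteI)
             (simp_all add: g_def r_def binomial_ring sum_distrib_left norm_mult norm_power)
        show "(\<lambda>n. norm (b n) * r ^ n) summable_on UNIV"
          using norm_summable_imp_summable_on[of "\<lambda>n. norm (b n) * r ^ n"] summ r
          by (simp add: norm_mult norm_power norm_b abs_mult)
      qed auto
      thus "g summable_on (SIGMA n : UNIV. {..n})"
        by (rule abs_summable_summable)
    qed
    \<comment> \<open>The term for \<open>(n, k)\<close> is the monomial \<open>x\<^bsup>2k\<^esup> y\<^bsup>2(n-k)\<^esup>\<close>.\<close>
    also have "?this \<longleftrightarrow> ((\<lambda>(j, i). F $ j $ i * x ^ i * y ^ j) has_sum csqrt (1 - x\<^sup>2 - y\<^sup>2))
                 {(j, i). even j \<and> even i}"
      by (rule has_sum_reindex_bij_witness[of _ "\<lambda>(j, i). ((i + j) div 2, i div 2)"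
            "\<lambda>(n, k). (2 * (n - k), 2 * k)"])
         (auto simp: F_def g_def power_mult elim!: evenE)
    also have "\<dots> \<longleftrightarrow> ((\<lambda>(j, i). F $ j $ i * x ^ i * y ^ j) has_sum csqrt (1 - x\<^sup>2 - y\<^sup>2)) UNIV"
      by (rule has_sum_cong_neutral) (auto simp: F_def split: if_splits)
    finally show "((\<lambda>(j, i). F $ j $ i * x ^ i * y ^ j) has_sum csqrt (1 - x\<^sup>2 - y\<^sup>2)) UNIV" .
  qed simp
  thus ?thesis by blast
qed

lemma has_expansion2_poly:
  "has_expansion2 (\<lambda>x _. poly A x) (fps_const (fps_of_poly A))"
proof (induction A)
  case 0
  show ?case using has_expansion2_const[of 0] by simp
next
  case (pCons a A)
  have "has_expansion2 (\<lambda>x y. a + x * poly A x)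
          (fps_const (fps_const a) + fps_const fps_X * fps_const (fps_of_poly A))"
    by (intro has_expansion2_add has_expansion2_mult has_expansion2_const
        has_expansion2_fst pCons.IH)
  thus ?case by (simp add: fps_of_poly_pCons mult.commute add.commute)
qed

unbundle no fps_syntax
unbundle vec_syntax

section \<open>The order of vanishing on a conic\<close>

text \<open>The elements \<open>A + z\<^sub>3 B\<close> of the coordinate ring of the conic have nonzero norm because \<open>1 - X\<^sup>2\<close> is
  not a square: it has a simple zero at \<open>1\<close>, so \<open>A\<^sup>2 = (1 - X\<^sup>2) B\<^sup>2\<close> would equate an even with an odd
  order of vanishing.\<close>
lemma conic_norm_nonzero:
  fixes A B :: "complex poly"
  assumes "A \<noteq> 0 \<or> B \<noteq> 0"
  shows "A\<^sup>2 - [:1, 0, -1:] * B\<^sup>2 \<noteq> 0"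
proof
  assume N: "A\<^sup>2 - [:1, 0, -1:] * B\<^sup>2 = 0"
  hence eq: "A\<^sup>2 = [:1, 0, -1:] * B\<^sup>2" by simp
  have B: "B \<noteq> 0" using eq assms by auto
  have "order 1 ([:1, 0, -1:] :: complex poly) = order 1 ([:-1, 1:] * [:-1, -1:] :: complex poly)"
    by simp
  also have "\<dots> = order 1 ([:-1, 1:] :: complex poly) + order 1 ([:-1, -1:] :: complex poly)"
    by (rule order_mult) simp
  also have "order 1 ([:-1, 1:] :: complex poly) = 1"
    using order_power_n_n[of "1 :: complex" 1] by simp
  also have "order 1 ([:-1, -1:] :: complex poly) = 0"
    by (rule order_0I) simp
  finally have "order 1 ([:1, 0, -1:] :: complex poly) = 1" by simp
  moreover have "order 1 (A\<^sup>2) = order 1 ([:1, 0, -1:] :: complex poly) + order 1 (B\<^sup>2)"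
    unfolding eq by (rule order_mult) (use B in \<open>simp del: mult_pCons_left\<close>)
  moreover have "order 1 (P\<^sup>2) = 2 * order 1 P" if "P \<noteq> 0" for P :: "complex poly"
    using order_mult[of P P 1] that by (simp add: power2_eq_square)
  moreover have "A \<noteq> 0"
    using eq B by (auto simp del: mult_pCons_left)
  ultimately have "2 * order 1 A = 1 + 2 * order 1 B" using B by simp
  thus False by presburger
qed

text \<open>The norm of \<open>F = A + s B\<close> is a multiple of \<open>F\<close> and a polynomial of degree at most \<open>2 m\<close>, and its order
  at \<open>0\<close> cannot exceed its degree. The bounds on \<open>A\<close> and \<open>B\<close> say that \<open>A + z\<^sub>3 B\<close> has degree at most \<open>m\<close>.\<close>
lemma conic_order_bound:
  fixes A B :: "complex poly" and s :: "complex fps"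
  assumes s: "s\<^sup>2 = 1 - fps_X\<^sup>2"
    and A: "\<And>n. n > m \<Longrightarrow> coeff A n = 0" and B: "\<And>n. n \<ge> m \<Longrightarrow> coeff B n = 0"
    and nz: "A \<noteq> 0 \<or> B \<noteq> 0"
  defines "F \<equiv> fps_of_poly A + s * fps_of_poly B"
  shows "F \<noteq> 0" "subdegree F \<le> 2 * m"
proof -
  define N where "N = A\<^sup>2 - [:1, 0, -1:] * B\<^sup>2"
  define G where "G = fps_of_poly A - s * fps_of_poly B"
  have "N \<noteq> 0" unfolding N_def by (rule conic_norm_nonzero[OF nz])
  have conic: "fps_of_poly [:1, 0, -1:] = (1 - fps_X\<^sup>2 :: complex fps)"
    by (simp add: fps_of_poly_pCons power2_eq_square)
  have "fps_of_poly N = (fps_of_poly A)\<^sup>2 - s\<^sup>2 * (fps_of_poly B)\<^sup>2"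
    unfolding N_def fps_of_poly_diff fps_of_poly_mult fps_of_poly_power conic s ..
  also have "\<dots> = F * G"
    by (simp add: F_def G_def algebra_simps power2_eq_square)
  finally have FG: "fps_of_poly N = F * G" .
  have FG0: "F * G \<noteq> 0"
    using \<open>N \<noteq> 0\<close> by (simp flip: FG)
  thus "F \<noteq> 0" by auto
  have dA: "degree A \<le> m" using A by (rule degree_le[rule_format]) 
  have "degree (A\<^sup>2) \<le> 2 * m"
    using degree_power_le[of A 2] dA by simp
  moreover have "degree ([:1, 0, -1:] * B\<^sup>2) \<le> 2 * m"
  proof (cases "B = 0")
    case False
    hence "degree B < m" using B by (metis leading_coeff_0_iff not_le)
    moreover have "degree ([:1, 0, -1:] * B\<^sup>2) \<le> 2 + degree B * 2"
      using degree_mult_le[of "[:1, 0, -1:]" "B\<^sup>2"] degree_power_le[of B 2] by simp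
    ultimately show ?thesis by linarith
  qed simp
  ultimately have "degree N \<le> 2 * m"
    unfolding N_def by (rule degree_diff_le)
  have "subdegree F \<le> subdegree (F * G)"
    using FG0 by simp
  also have "\<dots> \<le> degree N"
    by (rule subdegree_leI) (use \<open>N \<noteq> 0\<close> in \<open>simp flip: FG\<close>)
  finally show "subdegree F \<le> 2 * m" using \<open>degree N \<le> 2 * m\<close> by simp
qed

section \<open>Germs at the pole of the sphere\<close>

definition graph_point :: "complex \<Rightarrow> complex \<Rightarrow> complex ^ 3" where
  "graph_point x y = vector [x, y, csqrt (1 - x\<^sup>2 - y\<^sup>2)]"

lemma graph_point_nth [simp]:
  "graph_point x y $ 1 = x" "graph_point x y $ 2 = y"
  "graph_point x y $ 3 = csqrt (1 - x\<^sup>2 - y\<^sup>2)"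
  by (simp_all add: graph_point_def)

lemma graph_point_in_sphere [simp]: "graph_point x y \<in> complex_sphere"
  by (simp add: complex_sphere_def)

abbreviation germ :: "(complex ^ 3 \<Rightarrow> complex) \<Rightarrow> complex \<Rightarrow> complex \<Rightarrow> complex" where
  "germ f \<equiv> \<lambda>x y. f (graph_point x y)"

abbreviation pole :: "complex ^ 3" where
  "pole \<equiv> vector [0, 0, 1]"

abbreviation coords :: "complex ^ 3 \<Rightarrow> complex ^ 2" where
  "coords \<equiv> \<lambda>z. vector [z $ 1, z $ 2]"

lemma graph_point_near_pole:
  assumes "e > 0"
  obtains \<delta> where "\<delta> > 0"
    "\<And>x y. norm x < \<delta> \<Longrightarrow> norm y < \<delta> \<Longrightarrow> graph_point x y \<in> ball pole e"
proof -
  have "isCont (\<lambda>p::complex \<times> complex. csqrt (1 - (fst p)\<^sup>2 - (snd p)\<^sup>2)) (0, 0)"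
    by (intro continuous_intros isCont_o2[OF _ isCont_csqrt']) auto
  moreover have "e / 3 > 0" using assms by simp
  ultimately have "\<exists>d>0. \<forall>p. dist p (0, 0) < d \<longrightarrow>
           dist (csqrt (1 - (fst p)\<^sup>2 - (snd p)\<^sup>2)) (csqrt (1 - 0\<^sup>2 - 0\<^sup>2)) < e / 3"
    unfolding continuous_at_eps_delta fst_conv snd_conv by blast
  then obtain d where d: "d > 0"
    and near: "\<And>p. dist p (0, 0) < d \<Longrightarrow>
           dist (csqrt (1 - (fst p)\<^sup>2 - (snd p)\<^sup>2)) 1 < e / 3"
    by auto
  show ?thesis
  proof (rule that[of "min (d / 2) (e / 3)"])
    fix x y :: complex
    assume x: "norm x < min (d / 2) (e / 3)" and y: "norm y < min (d / 2) (e / 3)"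
    have "norm (x, y) \<le> norm x + norm y" by (rule norm_Pair_le)
    hence "norm (csqrt (1 - x\<^sup>2 - y\<^sup>2) - 1) < e / 3"
      using near[of "(x, y)"] x y by (simp add: dist_norm)
    moreover have "dist (graph_point x y) pole \<le>
        norm x + norm y + norm (csqrt (1 - x\<^sup>2 - y\<^sup>2) - 1)"
      using L2_set_le_sum[of UNIV "\<lambda>i. norm ((graph_point x y - pole) $ i)"]
      by (simp add: dist_norm norm_vec_def sum_3)
    ultimately show "graph_point x y \<in> ball pole e"
      using x y by (simp add: dist_commute)
  qed (use d assms in auto)
qed

text \<open>Near the pole the sphere is the graph of the square root, so a neighbourhood of the pole in the
  sphere is parametrised by small \<open>(x, y)\<close>.\<close>
lemma has_power_series_at_pole_iff:
  "has_power_series_at complex_sphere pole coords f c \<longleftrightarrow>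
     has_expansion2 (germ f) (Abs_fps (\<lambda>j. Abs_fps (\<lambda>i. c (vector [i, j]))))"
  (is "_ \<longleftrightarrow> has_expansion2 _ ?F")
proof -
  have reindex: "((\<lambda>\<alpha>. c \<alpha> * (coords z $ 1) ^ (\<alpha> $ 1) * (coords z $ 2) ^ (\<alpha> $ 2)) has_sum S) UNIV \<longleftrightarrow>
      ((\<lambda>(j, i). fps_nth (fps_nth ?F j) i * (z $ 1) ^ i * (z $ 2) ^ j) has_sum S) UNIV" for z S
    by (rule has_sum_reindex_bij_witness[of _ "\<lambda>(j, i). vector [i, j]" "\<lambda>\<alpha>. (\<alpha> $ 2, \<alpha> $ 1)"])
       (auto simp: vec_eq_iff forall_2 intro!: arg_cong[of _ _ c])
  show ?thesis
  proof
    assume "has_power_series_at complex_sphere pole coords f c"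
    then obtain e where e: "e > 0"
      and ps: "\<And>z. z \<in> complex_sphere \<inter> ball pole e \<Longrightarrow>
        ((\<lambda>\<alpha>. c \<alpha> * (coords z $ 1) ^ (\<alpha> $ 1) * (coords z $ 2) ^ (\<alpha> $ 2)) has_sum f z) UNIV"
      unfolding has_power_series_at_def by blast
    obtain \<delta> where \<delta>: "\<delta> > 0"
      "\<And>x y. norm x < \<delta> \<Longrightarrow> norm y < \<delta> \<Longrightarrow> graph_point x y \<in> ball pole e"
      using graph_point_near_pole[OF e] by blast
    show "has_expansion2 (germ f) ?F"
    proof (rule has_expansion2I[OF \<delta>(1)])
      fix x y :: complex assume "norm x < \<delta>" "norm y < \<delta>"
      with \<delta> have "graph_point x y \<in> complex_sphere \<inter> ball pole e" by simp
      from ps[OF this, unfolded reindex]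
      show "((\<lambda>(j, i). fps_nth (fps_nth ?F j) i * x ^ i * y ^ j) has_sum f (graph_point x y)) UNIV"
        by simp
    qed
  next
    assume "has_expansion2 (germ f) ?F"
    then obtain \<delta> where \<delta>: "\<delta> > 0"
      and ex: "\<And>x y. norm x < \<delta> \<Longrightarrow> norm y < \<delta> \<Longrightarrow>
        ((\<lambda>(j, i). fps_nth (fps_nth ?F j) i * x ^ i * y ^ j) has_sum f (graph_point x y)) UNIV"
      unfolding has_expansion2_def by blast
    show "has_power_series_at complex_sphere pole coords f c"
      unfolding has_power_series_at_def
    \<comment> \<open>The radius \<open>1\<close> keeps \<open>z\<close> on the sheet where \<open>z\<^sub>3\<close> is the principal square root.\<close>
    proof (intro exI[of _ "min \<delta> 1"] conjI ballI)
      fix z assume z: "z \<in> complex_sphere \<inter> ball pole (min \<delta> 1)"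
      hence "z $ 3 = csqrt (1 - (z $ 1)\<^sup>2 - (z $ 2)\<^sup>2)"
        using complex_sphere_graph[of z] by simp
      hence "z = graph_point (z $ 1) (z $ 2)"
        by (simp add: vec_eq_iff forall_3)
      moreover have "norm (z $ 1) < \<delta>" "norm (z $ 2) < \<delta>"
        using z dist_vec_nth_le[of z 1 pole] dist_vec_nth_le[of z 2 pole]
        by (auto simp: dist_commute)
      ultimately show
        "((\<lambda>\<alpha>. c \<alpha> * (coords z $ 1) ^ (\<alpha> $ 1) * (coords z $ 2) ^ (\<alpha> $ 2)) has_sum f z) UNIV"
        unfolding reindex using ex[of "z $ 1" "z $ 2"] by simp
    qed (use \<delta> in auto)
  qed
qed

text \<open>The exponents of \<open>F\<close> have a lexicographically smallest one: the lowest power of \<open>Y\<close>, and in its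
  coefficient the lowest power of \<open>X\<close>. Uniqueness of the expansion makes the definite description
  well defined.\<close>
lemma valuation_eq_subdegrees:
  assumes F: "has_expansion2 (germ f) F" and nz: "F \<noteq> 0"
  shows "valuation complex_sphere pole coords f =
           vector [subdegree (fps_nth F (subdegree F)), subdegree F]" (is "_ = ?\<alpha>")
  unfolding valuation_def
proof (rule the_equality)
  define c :: "nat ^ 2 \<Rightarrow> complex" where "c \<alpha> = fps_nth (fps_nth F (\<alpha> $ 2)) (\<alpha> $ 1)" for \<alpha>
  have c: "Abs_fps (\<lambda>j. Abs_fps (\<lambda>i. c (vector [i, j]))) = F"
    by (simp add: c_def fps_eq_iff)
  have nz': "c ?\<alpha> \<noteq> 0"
    using nz by (simp add: c_def)
  have min: "lex_less ?\<alpha> \<beta>" if "c \<beta> \<noteq> 0" "\<beta> \<noteq> ?\<alpha>" for \<beta>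
  proof -
    have 2: "subdegree F \<le> \<beta> $ 2"
      using that(1) by (intro subdegree_leI) (auto simp: c_def)
    have 1: "subdegree (fps_nth F (\<beta> $ 2)) \<le> \<beta> $ 1"
      using that(1) by (intro subdegree_leI) (auto simp: c_def)
    show ?thesis
      using 1 2 that(2) by (auto simp: lex_less_def vec_eq_iff forall_2 le_less)
  qed
  show "\<exists>c. has_power_series_at complex_sphere pole coords f c \<and> c ?\<alpha> \<noteq> 0 \<and>
          (\<forall>\<beta>. c \<beta> \<noteq> 0 \<and> \<beta> \<noteq> ?\<alpha> \<longrightarrow> lex_less ?\<alpha> \<beta>)"
    using F nz' min by (intro exI[of _ c]) (auto simp: has_power_series_at_pole_iff c)
  fix \<gamma>
  assume "\<exists>c. has_power_series_at complex_sphere pole coords f c \<and> c \<gamma> \<noteq> 0 \<and>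
            (\<forall>\<beta>. c \<beta> \<noteq> 0 \<and> \<beta> \<noteq> \<gamma> \<longrightarrow> lex_less \<gamma> \<beta>)"
  then obtain d where d: "has_power_series_at complex_sphere pole coords f d" "d \<gamma> \<noteq> 0"
    and mind: "\<And>\<beta>. d \<beta> \<noteq> 0 \<Longrightarrow> \<beta> \<noteq> \<gamma> \<Longrightarrow> lex_less \<gamma> \<beta>" by blast
  have "Abs_fps (\<lambda>j. Abs_fps (\<lambda>i. d (vector [i, j]))) = F"
    using d(1) F by (auto simp: has_power_series_at_pole_iff intro: has_expansion2_unique)
  hence "d (vector [\<beta> $ 1, \<beta> $ 2]) = c \<beta>" for \<beta>
    by (auto simp: c_def)
  moreover have "vector [\<beta> $ 1, \<beta> $ 2] = \<beta>" for \<beta> :: "nat ^ 2"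
    by (simp add: vec_eq_iff forall_2)
  ultimately have "d = c" by auto
  show "\<gamma> = ?\<alpha>"
  proof (rule ccontr)
    assume "\<gamma> \<noteq> ?\<alpha>"
    with d(2) nz' min[of \<gamma>] mind[of ?\<alpha>] \<open>d = c\<close>
    have "lex_less ?\<alpha> \<gamma>" "lex_less \<gamma> ?\<alpha>" by auto
    thus False by (auto simp: lex_less_def)
  qed
qed

section \<open>Polynomial functions on the sphere\<close>

text \<open>Polynomial functions of degree less than \<open>k\<close>. The strict bound leaves only the zero function at
  \<open>k = 0\<close>, so that splitting off a factor \<open>z\<^sub>2\<close> lowers \<open>k\<close> by one even for constants, and
  inductions can start from the zero function.\<close>
inductive polyfun_lt :: "nat \<Rightarrow> (complex ^ 3 \<Rightarrow> complex) \<Rightarrow> bool" where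
  zero: "polyfun_lt k (\<lambda>_. 0)"
| const: "polyfun_lt (Suc k) (\<lambda>_. c)"
| add: "polyfun_lt k f \<Longrightarrow> polyfun_lt k g \<Longrightarrow> polyfun_lt k (\<lambda>z. f z + g z)"
| coord: "polyfun_lt k f \<Longrightarrow> polyfun_lt (Suc k) (\<lambda>z. z $ i * f z)"

lemma polyfun_lt_mono: "polyfun_lt k f \<Longrightarrow> k \<le> l \<Longrightarrow> polyfun_lt l f"
proof (induction arbitrary: l rule: polyfun_lt.induct)
  case (zero k)
  show ?case by (rule polyfun_lt.zero)
next
  case (const k c)
  then obtain m where "l = Suc m" by (cases l) auto
  thus ?case by (simp only: polyfun_lt.const)
next
  case (add k f g)
  show ?case by (rule polyfun_lt.add) (use add in blast)+
next
  case (coord k f i)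
  then obtain m where "l = Suc m" "k \<le> m" by (cases l) auto
  thus ?case using polyfun_lt.coord[OF coord.IH] by blast
qed

lemma polyfun_lt_cmult: "polyfun_lt k f \<Longrightarrow> polyfun_lt k (\<lambda>z. c * f z)"
proof (induction rule: polyfun_lt.induct)
  case (zero k)
  show ?case by (simp add: polyfun_lt.zero)
next
  case (const k d)
  show ?case by (rule polyfun_lt.const)
next
  case (add k f g)
  from polyfun_lt.add[OF add.IH] show ?case by (simp add: distrib_left)
next
  case (coord k f i)
  from polyfun_lt.coord[OF coord.IH, of i] show ?case by (simp add: mult_ac)
qed

lemma polyfun_lt_sum:
  assumes "\<And>a. a \<in> A \<Longrightarrow> polyfun_lt k (f a)"
  shows "polyfun_lt k (\<lambda>z. \<Sum>a\<in>A. f a z)"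
  using assms
proof (induction A rule: infinite_finite_induct)
  case (insert a A)
  from insert have "polyfun_lt k (\<lambda>z. f a z + (\<Sum>a\<in>A. f a z))"
    by (intro polyfun_lt.add) auto
  thus ?case using insert.hyps by simp
qed (simp_all add: polyfun_lt.zero)

lemma polyfun_lt_0_imp_eq_0: "polyfun_lt 0 f \<Longrightarrow> f z = 0"
  by (induction "0 :: nat" f rule: polyfun_lt.induct) auto

lemma polyfun_lt_coord_power:
  assumes "polyfun_lt k f"
  shows "polyfun_lt (k + n) (\<lambda>z. (z $ i) ^ n * f z)"
proof (induction n)
  case (Suc n)
  from polyfun_lt.coord[OF this, of i] show ?case by (simp add: mult_ac)
qed (use assms in simp)

lemma polyfun_lt_poly:
  assumes "\<And>n. n \<ge> k \<Longrightarrow> coeff A n = 0"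
  shows "polyfun_lt k (\<lambda>z. poly A (z $ i))"
  using assms
proof (induction A arbitrary: k)
  case (pCons a A)
  show ?case
  proof (cases k)
    case 0
    hence "pCons a A = 0" using pCons.prems by (intro poly_eqI) simp
    thus ?thesis by (simp_all add: polyfun_lt.zero)
  next
    case (Suc l)
    have "coeff A n = 0" if "n \<ge> l" for n
      using pCons.prems[of "Suc n"] Suc that by simp
    hence "polyfun_lt l (\<lambda>z. poly A (z $ i))"
      by (rule pCons.IH)
    from polyfun_lt.add[OF polyfun_lt.const[of l a] polyfun_lt.coord[OF this]]
    show ?thesis by (simp add: Suc)
  qed
qed (simp_all add: polyfun_lt.zero)

lemma polyfun_lt_eval3:
  assumes "degree_le p k"
  shows "polyfun_lt (Suc k) (eval3 p)"
  unfolding eval3_def[abs_def]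
proof (rule polyfun_lt_sum, rule polyfun_lt_cmult)
  fix m assume m: "m \<in> Poly_Mapping.keys p"
  have "polyfun_lt (Suc 0 + m $ 3 + m $ 2 + m $ 1)
          (\<lambda>z. (z $ 1) ^ (m $ 1) * ((z $ 2) ^ (m $ 2) * ((z $ 3) ^ (m $ 3) * 1)))"
    by (rule polyfun_lt_coord_power polyfun_lt.const)+
  moreover have "Suc 0 + m $ 3 + m $ 2 + m $ 1 \<le> Suc k"
    using assms m by (auto simp: degree_le_def sum_3)
  ultimately have "polyfun_lt (Suc k)
      (\<lambda>z. (z $ 1) ^ (m $ 1) * ((z $ 2) ^ (m $ 2) * ((z $ 3) ^ (m $ 3) * 1)))"
    by (rule polyfun_lt_mono)
  thus "polyfun_lt (Suc k) (\<lambda>z. \<Prod>i\<in>UNIV. (z $ i) ^ (m $ i))"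
    unfolding UNIV_3 by simp
qed

lemma polyfun_lt_has_expansion2:
  assumes "polyfun_lt k f"
  shows "\<exists>F. has_expansion2 (germ f) F"
  using assms
proof (induction rule: polyfun_lt.induct)
  case (zero k)
  show ?case using has_expansion2_const by blast
next
  case (const k c)
  show ?case using has_expansion2_const by blast
next
  case (add k f g)
  then obtain F G where "has_expansion2 (germ f) F" "has_expansion2 (germ g) G" by blast
  from has_expansion2_add[OF this] show ?case by blast
next
  case (coord k f i)
  then obtain F where F: "has_expansion2 (germ f) F" by blast
  have "\<exists>G. has_expansion2 (germ (\<lambda>z. z $ i)) G"
    using exhaust_3[of i] has_expansion2_fst has_expansion2_snd has_expansion2_csqrt by auto
  then obtain G where "has_expansion2 (germ (\<lambda>z. z $ i)) G" by blast
  from has_expansion2_mult[OF this F] show ?case by blast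
qed

text \<open>Everything divisible by \<open>z\<^sub>2\<close> is collected in \<open>g\<close>, and \<open>z\<^sub>3\<^sup>2 = 1 - z\<^sub>1\<^sup>2 - z\<^sub>2\<^sup>2\<close> reduces the rest to
  degree at most one in \<open>z\<^sub>3\<close>. The induction works because multiplication by each coordinate
  preserves this form: the one interesting case is \<open>z\<^sub>3 (A + z\<^sub>3 B + z\<^sub>2 g) =
  (1 - z\<^sub>1\<^sup>2) B + z\<^sub>3 A + z\<^sub>2 (z\<^sub>3 g - z\<^sub>2 B)\<close>. The degree bounds survive since every rewriting step
  replaces a quadratic polynomial by another one.\<close>
lemma polyfun_lt_sphere_decomp:
  assumes "polyfun_lt k f"
  shows "\<exists>A B g. (\<forall>n\<ge>k. coeff A n = 0) \<and> (\<forall>n\<ge>k - 1. coeff B n = 0) \<and> polyfun_lt (k - 1) g \<and>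
           (\<forall>z\<in>complex_sphere. f z = poly A (z $ 1) + z $ 3 * poly B (z $ 1) + z $ 2 * g z)"
  using assms
proof (induction rule: polyfun_lt.induct)
  case (zero k)
  show ?case
    by (rule exI[of _ "0 :: complex poly"],
        rule exI[of _ "0 :: complex poly"],
        rule exI[of _ "\<lambda>_. 0 :: complex"])
       (simp_all add: polyfun_lt.zero)
next
  case (const k c)
  show ?case
    by (rule exI[of _ "[:c:]"],
        rule exI[of _ "0 :: complex poly"],
        rule exI[of _ "\<lambda>_. 0 :: complex"])
       (auto simp: polyfun_lt.zero coeff_pCons split: nat.splits)
next
  case (add k f1 f2)
  then obtain A1 B1 g1 A2 B2 g2 where
    1: "\<forall>n\<ge>k. coeff A1 n = 0" "\<forall>n\<ge>k - 1. coeff B1 n = 0" "polyfun_lt (k - 1) g1"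
       "\<forall>z\<in>complex_sphere. f1 z = poly A1 (z $ 1) + z $ 3 * poly B1 (z $ 1) + z $ 2 * g1 z" and
    2: "\<forall>n\<ge>k. coeff A2 n = 0" "\<forall>n\<ge>k - 1. coeff B2 n = 0" "polyfun_lt (k - 1) g2"
       "\<forall>z\<in>complex_sphere. f2 z = poly A2 (z $ 1) + z $ 3 * poly B2 (z $ 1) + z $ 2 * g2 z"
    by blast
  have g: "polyfun_lt (k - 1) (\<lambda>z. g1 z + g2 z)"
    by (rule polyfun_lt.add[OF 1(3) 2(3)])
  show ?case
    by (rule exI[of _ "A1 + A2"],
        rule exI[of _ "B1 + B2"],
        rule exI[of _ "\<lambda>z. g1 z + g2 z"])
       (use 1 2 g in \<open>auto simp: algebra_simps\<close>)
next
  case (coord k f i)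
  then obtain A B g where
    A: "\<And>n. n \<ge> k \<Longrightarrow> coeff A n = 0" and B: "\<And>n. n \<ge> k - 1 \<Longrightarrow> coeff B n = 0" and
    g: "polyfun_lt (k - 1) g" and
    f: "\<And>z. z \<in> complex_sphere \<Longrightarrow>
          f z = poly A (z $ 1) + z $ 3 * poly B (z $ 1) + z $ 2 * g z"
    by blast
  show ?case
  proof (cases k)
    case 0
    \<comment> \<open>The truncated bound \<open>k - 1\<close> does not grow from \<open>k = 0\<close> to \<open>k = 1\<close>, so this case is separate.\<close>
    hence "f z = 0" for z using coord.hyps polyfun_lt_0_imp_eq_0 by blast
    note f0 = this
    show ?thesis
      by (rule exI[of _ "0 :: complex poly"],
          rule exI[of _ "0 :: complex poly"],
          rule exI[of _ "\<lambda>_. 0 :: complex"])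
         (simp_all add: f0 polyfun_lt.zero)
  next
    case (Suc l)
    have coord_g: "polyfun_lt k (\<lambda>z. z $ i * g z)" for i
      using polyfun_lt.coord[OF g, of i] Suc by simp
    consider (1) "i = 1" | (2) "i = 2" | (3) "i = 3"
      using exhaust_3[of i] by blast
    thus ?thesis
    proof cases
      case 1
      show ?thesis
      proof (rule exI[of _ "pCons 0 A"],
          rule exI[of _ "pCons 0 B"],
          rule exI[of _ "\<lambda>z. z $ 1 * g z"],
          intro conjI ballI)
        show "\<forall>n\<ge>Suc k. coeff (pCons 0 A) n = 0"
          using A by (auto simp: coeff_pCons split: nat.splits)
        show "\<forall>n\<ge>Suc k - 1. coeff (pCons 0 B) n = 0"
          using B Suc by (auto simp: coeff_pCons split: nat.splits)
        show "polyfun_lt (Suc k - 1) (\<lambda>z. z $ 1 * g z)" using coord_g by simp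
        show "z $ i * f z = poly (pCons 0 A) (z $ 1) + z $ 3 * poly (pCons 0 B) (z $ 1) +
                z $ 2 * (z $ 1 * g z)" if "z \<in> complex_sphere" for z
          unfolding 1 f[OF that] by (simp add: algebra_simps)
      qed
    next
      case 2
      show ?thesis
        by (rule exI[of _ "0 :: complex poly"], rule exI[of _ "0 :: complex poly"],
          rule exI[of _ f]) (use 2 coord.hyps in auto)
    next
      case 3
      show ?thesis
      proof (rule exI[of _ "[:1, 0, -1:] * B"],
          rule exI[of _ A],
          rule exI[of _ "\<lambda>z. z $ 3 * g z + z $ 2 * ((-1) * poly B (z $ 1))"],
          intro conjI ballI)
        show "\<forall>n\<ge>Suc k. coeff ([:1, 0, -1:] * B) n = 0"
          using B Suc by (auto simp: coeff_pCons split: nat.splits)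
        show "\<forall>n\<ge>Suc k - 1. coeff A n = 0" using A by simp
        have "polyfun_lt (k - 1) (\<lambda>z. (-1) * poly B (z $ 1))"
          using B by (rule polyfun_lt_cmult[OF polyfun_lt_poly])
        from polyfun_lt.coord[OF this, of 2]
        show "polyfun_lt (Suc k - 1) (\<lambda>z. z $ 3 * g z + z $ 2 * ((-1) * poly B (z $ 1)))"
          using coord_g[of 3] Suc by (simp only: diff_Suc_1) (rule polyfun_lt.add, simp_all)
        fix z assume z: "z \<in> complex_sphere"
        hence "(z $ 3)\<^sup>2 = 1 - (z $ 1)\<^sup>2 - (z $ 2)\<^sup>2"
          by (simp add: complex_sphere_def algebra_simps)
        hence z3: "z $ 3 * z $ 3 = 1 - (z $ 1)\<^sup>2 - (z $ 2)\<^sup>2"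
          by (simp add: power2_eq_square)
        have "z $ i * f z = z $ 3 * poly A (z $ 1) + (z $ 3 * z $ 3) * poly B (z $ 1) +
                z $ 2 * (z $ 3 * g z)"
          unfolding 3 f[OF z] by (simp add: algebra_simps)
        also have "\<dots> = poly ([:1, 0, -1:] * B) (z $ 1) + z $ 3 * poly A (z $ 1) +
                z $ 2 * (z $ 3 * g z + z $ 2 * ((-1) * poly B (z $ 1)))"
          unfolding z3 by (simp add: algebra_simps power2_eq_square)
        finally show "z $ i * f z = poly ([:1, 0, -1:] * B) (z $ 1) + z $ 3 * poly A (z $ 1) +
                z $ 2 * (z $ 3 * g z + z $ 2 * ((-1) * poly B (z $ 1)))" .
      qed
    qed
  qed
qed

section \<open>The valuations of polynomial functions\<close>

text \<open>On the curve \<open>z\<^sub>2 = 0\<close>, that is, in the coefficient of \<open>Y\<^sup>0\<close>, the series of \<open>z\<^sub>3\<close> is a square root of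
  \<open>1 - X\<^sup>2\<close>: by uniqueness, its square is the expansion of \<open>z\<^sub>3\<^sup>2 = 1 - z\<^sub>1\<^sup>2 - z\<^sub>2\<^sup>2\<close>.\<close>
lemma sqrt_row_squared:
  assumes "has_expansion2 (germ (\<lambda>z. z $ 3)) S"
  shows "(fps_nth S 0)\<^sup>2 = 1 - fps_X\<^sup>2"
proof -
  have SS: "has_expansion2 (\<lambda>x y. (csqrt (1 - x\<^sup>2 - y\<^sup>2))\<^sup>2) (S * S)"
    using has_expansion2_mult[OF assms assms] by (simp add: power2_eq_square)
  have R: "has_expansion2 (\<lambda>x y. 1 + ((-1) * (x * x) + (-1) * (y * y)))
     (fps_const (fps_const 1) + (fps_const (fps_const (-1)) * (fps_const fps_X * fps_const fps_X) +
        fps_const (fps_const (-1)) * (fps_X * fps_X)))" (is "has_expansion2 _ ?R")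
    by (intro has_expansion2_add has_expansion2_mult has_expansion2_const
        has_expansion2_fst has_expansion2_snd)
  have eq: "(\<lambda>x y. (csqrt (1 - x\<^sup>2 - y\<^sup>2))\<^sup>2) =
      (\<lambda>x y. 1 + ((-1) * (x * x) + (-1) * (y * y)))"
    unfolding power2_csqrt by (simp add: power2_eq_square fun_eq_iff)
  from SS[unfolded eq] R have "S * S = ?R"
    by (rule has_expansion2_unique)
  hence "fps_nth (S * S) 0 = fps_nth ?R 0" by simp
  hence "(fps_nth S 0)\<^sup>2 = 1 + fps_const (-1) * fps_X\<^sup>2"
    by (simp add: power2_eq_square)
  also have "fps_const (-1) * fps_X\<^sup>2 = - (fps_X\<^sup>2 :: complex fps)"
    by (rule fps_ext) simp
  finally show ?thesis by simp
qed

text \<open>If \<open>f\<close> does not vanish on the conic \<open>z\<^sub>2 = 0\<close>, then \<open>F\<close> has \<open>Y\<close>-order \<open>0\<close> and the norm argument bounds the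
  \<open>X\<close>-order. Otherwise \<open>A = B = 0\<close>, and \<open>f = z\<^sub>2 g\<close> is handled by induction. As \<open>f\<close> has degree less
  than \<open>k\<close>, the bound \<open>2 (k - 1)\<close> is written without subtraction.\<close>
lemma polyfun_lt_order_bound:
  assumes "polyfun_lt k f" "\<exists>z\<in>complex_sphere. f z \<noteq> 0" "has_expansion2 (germ f) F"
  shows "F \<noteq> 0 \<and> subdegree (fps_nth F (subdegree F)) + 2 * subdegree F + 2 \<le> 2 * k"
  using assms
proof (induction k arbitrary: f F)
  case 0
  thus ?case using polyfun_lt_0_imp_eq_0 by blast
next
  case (Suc k)
  obtain A B g where
    A: "\<And>n. n \<ge> Suc k \<Longrightarrow> coeff A n = 0" and B: "\<And>n. n \<ge> k \<Longrightarrow> coeff B n = 0" and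
    g: "polyfun_lt k g" and
    f: "\<And>z. z \<in> complex_sphere \<Longrightarrow>
          f z = poly A (z $ 1) + z $ 3 * poly B (z $ 1) + z $ 2 * g z"
    using polyfun_lt_sphere_decomp[OF Suc.prems(1)] unfolding diff_Suc_1 by blast
  obtain S where S: "has_expansion2 (germ (\<lambda>z. z $ 3)) S"
    using has_expansion2_csqrt by auto
  obtain G where G: "has_expansion2 (germ g) G"
    using polyfun_lt_has_expansion2[OF g] by blast
  have "has_expansion2 (\<lambda>x y. poly A x + graph_point x y $ 3 * poly B x + y * g (graph_point x y))
          (fps_const (fps_of_poly A) + S * fps_const (fps_of_poly B) + fps_X * G)"
    by (intro has_expansion2_add has_expansion2_mult has_expansion2_poly S G has_expansion2_snd)
  hence F: "F = fps_const (fps_of_poly A) + S * fps_const (fps_of_poly B) + fps_X * G"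
    using has_expansion2_unique[OF Suc.prems(3)] by (simp add: f)
  show ?case
  proof (cases "A = 0 \<and> B = 0")
    case False
    have F0: "fps_nth F 0 = fps_of_poly A + fps_nth S 0 * fps_of_poly B"
      by (simp add: F)
    have "fps_nth F 0 \<noteq> 0" "subdegree (fps_nth F 0) \<le> 2 * k"
      unfolding F0
      using conic_order_bound[OF sqrt_row_squared[OF S], of k A B] A B False by auto
    thus ?thesis by auto
  next
    case True
    hence F': "F = fps_X * G" by (simp add: F)
    have "\<exists>z\<in>complex_sphere. g z \<noteq> 0"
      using Suc.prems(2) f True by force
    from Suc.IH[OF g this G]
    have IH: "G \<noteq> 0" "subdegree (fps_nth G (subdegree G)) + 2 * subdegree G + 2 \<le> 2 * k" by auto
    hence "subdegree F = Suc (subdegree G)" by (simp add: F')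
    thus ?thesis using IH by (simp add: F')
  qed
qed

lemma valuation_set_bound:
  assumes "\<alpha> \<in> valuation_set complex_sphere pole coords k"
  shows "\<alpha> $ 1 + 2 * \<alpha> $ 2 \<le> 2 * k"
proof -
  obtain p where p: "degree_le p k"
    and nz: "restrict (eval3 p) complex_sphere \<noteq> restrict (\<lambda>_. 0) complex_sphere"
    and \<alpha>: "\<alpha> = valuation complex_sphere pole coords (restrict (eval3 p) complex_sphere)"
    using assms by (auto simp: valuation_set_def coord_ring_le_def)
  have poly: "polyfun_lt (Suc k) (eval3 p)" by (rule polyfun_lt_eval3[OF p])
  have nz': "\<exists>z\<in>complex_sphere. eval3 p z \<noteq> 0"
  proof (rule ccontr)
    assume "\<not> ?thesis"
    hence "restrict (eval3 p) complex_sphere = restrict (\<lambda>_. 0) complex_sphere"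
      by (intro restrict_ext) blast
    with nz show False by contradiction
  qed
  obtain F where F: "has_expansion2 (germ (eval3 p)) F"
    using polyfun_lt_has_expansion2[OF poly] by blast
  have "F \<noteq> 0" "subdegree (fps_nth F (subdegree F)) + 2 * subdegree F \<le> 2 * k"
    using polyfun_lt_order_bound[OF poly nz' F] by simp_all
  moreover have "\<alpha> = vector [subdegree (fps_nth F (subdegree F)), subdegree F]"
    unfolding \<alpha> using F \<open>F \<noteq> 0\<close> by (intro valuation_eq_subdegrees) simp_all
  ultimately show ?thesis by simp
qed

lemma valuation_in_set:
  assumes p: "degree_le p k" and ex: "has_expansion2 (germ (eval3 p)) F" and "F \<noteq> 0"
  shows "vector [subdegree (fps_nth F (subdegree F)), subdegree F]
           \<in> valuation_set complex_sphere pole coords k"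
proof -
  let ?f = "restrict (eval3 p) complex_sphere"
  have "has_expansion2 (germ ?f) F" using ex by simp
  hence "valuation complex_sphere pole coords ?f =
           vector [subdegree (fps_nth F (subdegree F)), subdegree F]"
    using \<open>F \<noteq> 0\<close> by (rule valuation_eq_subdegrees)
  moreover have "?f \<noteq> restrict (\<lambda>_. 0) complex_sphere"
  proof
    assume eq: "?f = restrict (\<lambda>_. 0) complex_sphere"
    have "eval3 p (graph_point x y) = 0" for x y
      using fun_cong[OF eq, of "graph_point x y"] by simp
    hence "has_expansion2 (\<lambda>_ _. 0) F" using ex by simp
    with \<open>F \<noteq> 0\<close> show False using has_expansion2_0_imp_eq_0 by blast
  qed
  moreover have "?f \<in> coord_ring_le complex_sphere k"
    using p unfolding coord_ring_le_def by blast
  ultimately show ?thesis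
    unfolding valuation_set_def by (intro image_eqI[of _ _ ?f]) simp_all
qed

lemma eval3_single:
  "eval3 (Poly_Mapping.single m c) z = c * (\<Prod>i\<in>UNIV. (z $ i) ^ (m $ i))"
  by (simp add: eval3_def)

text \<open>The three vertices are attained by \<open>1\<close>, \<open>z\<^sub>2\<close> and \<open>1 - z\<^sub>3\<close>. For the last one, the order of \<open>1 - s\<close>
  follows from \<open>(1 - s)(1 + s) = X\<^sup>2\<close>, where \<open>1 + s\<close> is a unit because the branch of the square root
  has the value \<open>1\<close> at the origin.\<close>
lemma vertices_in_valuation_set:
  shows "vector [0, 0] \<in> valuation_set complex_sphere pole coords 1"
    and "vector [0, 1] \<in> valuation_set complex_sphere pole coords 1"
    and "vector [2, 0] \<in> valuation_set complex_sphere pole coords 1"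
proof -
  define e0 :: "nat ^ 3" where "e0 = 0"
  define e2 :: "nat ^ 3" where "e2 = axis 2 1"
  define e3 :: "nat ^ 3" where "e3 = axis 3 1"
  have e: "e0 $ 1 = 0" "e0 $ 2 = 0" "e0 $ 3 = 0" "e2 $ 1 = 0" "e2 $ 2 = 1" "e2 $ 3 = 0"
      "e3 $ 1 = 0" "e3 $ 2 = 0" "e3 $ 3 = 1"
    by (simp_all add: e0_def e2_def e3_def axis_def)
  have ne: "e0 \<noteq> e3" using e by auto
  have "vector [subdegree (fps_nth (1 :: complex fps fps) (subdegree (1 :: complex fps fps))),
      subdegree (1 :: complex fps fps)] \<in> valuation_set complex_sphere pole coords 1"
  proof (rule valuation_in_set)
    show "degree_le (Poly_Mapping.single e0 1) 1"
      by (simp add: degree_le_def sum_3 e)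
    have "eval3 (Poly_Mapping.single e0 1) z = 1" for z
      unfolding eval3_single UNIV_3 by (simp add: e)
    thus "has_expansion2 (germ (eval3 (Poly_Mapping.single e0 1))) 1"
      using has_expansion2_const[of 1] by simp
  qed simp
  thus "vector [0, 0] \<in> valuation_set complex_sphere pole coords 1" by simp
  have "vector [subdegree (fps_nth (fps_X :: complex fps fps) (subdegree (fps_X :: complex fps fps))),
      subdegree (fps_X :: complex fps fps)] \<in> valuation_set complex_sphere pole coords 1"
  proof (rule valuation_in_set)
    show "degree_le (Poly_Mapping.single e2 1) 1"
      by (simp add: degree_le_def sum_3 e)
    have "eval3 (Poly_Mapping.single e2 1) z = z $ 2" for z
      unfolding eval3_single UNIV_3 by (simp add: e)
    thus "has_expansion2 (germ (eval3 (Poly_Mapping.single e2 1))) fps_X"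
      using has_expansion2_snd by simp
  qed simp
  thus "vector [0, 1] \<in> valuation_set complex_sphere pole coords 1" by simp
  obtain S where S: "has_expansion2 (germ (\<lambda>z. z $ 3)) S"
    using has_expansion2_csqrt by auto
  define s where "s = fps_nth S 0"
  have s2: "s\<^sup>2 = 1 - fps_X\<^sup>2" unfolding s_def by (rule sqrt_row_squared[OF S])
  have s0: "fps_nth s 0 = 1"
  proof -
    obtain \<delta> where "\<delta> > 0" "\<And>x y. norm x < \<delta> \<Longrightarrow> norm y < \<delta> \<Longrightarrow>
       ((\<lambda>(j, i). fps_nth (fps_nth S j) i * x ^ i * y ^ j) has_sum graph_point x y $ 3) UNIV"
      using S unfolding has_expansion2_def by blast
    from this(2)[of 0 0] this(1)
    have "((\<lambda>(j, i). fps_nth (fps_nth S j) i * 0 ^ i * 0 ^ j) has_sum 1) UNIV" by simp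
    moreover have "((\<lambda>(j, i). fps_nth (fps_nth S j) i * 0 ^ i * 0 ^ j) has_sum fps_nth s 0) UNIV"
      by (rule has_sum_finite_neutralI[of "{(0, 0)}"]) (auto simp: s_def)
    ultimately show ?thesis using has_sum_unique by blast
  qed
  have "(1 - s) * (1 + s) = fps_X\<^sup>2"
    using s2 by (simp add: algebra_simps power2_eq_square)
  moreover from this have "1 - s \<noteq> 0" "1 + s \<noteq> 0" by auto
  ultimately have "subdegree (1 - s) + subdegree (1 + s) = 2"
    by (metis subdegree_mult fps_X_power_subdegree)
  moreover have "subdegree (1 + s) = 0"
    by (rule subdegree_eq_0) (simp add: s0)
  ultimately have sub: "subdegree (1 - s) = 2" by simp
  define R where "R = fps_const (fps_const 1) + fps_const (fps_const (-1)) * S"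
  have R0: "fps_nth R 0 = 1 - s"
    by (simp add: R_def s_def fps_eq_iff)
  have "vector [subdegree (fps_nth R (subdegree R)), subdegree R]
          \<in> valuation_set complex_sphere pole coords 1"
  proof (rule valuation_in_set)
    define p where "p = Poly_Mapping.single e0 1 + Poly_Mapping.single e3 (-1 :: complex)"
    have keys: "Poly_Mapping.keys p = {e0, e3}"
      using ne by (auto simp: p_def in_keys_iff lookup_add lookup_single when_def split: if_splits)
    show "degree_le p 1"
      by (auto simp: degree_le_def sum_3 e keys)
    have "eval3 p z = 1 + (-1) * z $ 3" for z
      unfolding eval3_def keys UNIV_3 using ne by (simp add: p_def lookup_add lookup_single e)
    thus "has_expansion2 (germ (eval3 p)) R"
      unfolding R_def by (simp only:) (intro has_expansion2_add has_expansion2_mult has_expansion2_const S)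
    show "R \<noteq> 0" using R0 \<open>1 - s \<noteq> 0\<close> by auto
  qed
  moreover have "subdegree R = 0" using R0 \<open>1 - s \<noteq> 0\<close> by (intro subdegree_eq_0) simp
  ultimately show "vector [2, 0] \<in> valuation_set complex_sphere pole coords 1"
    by (simp add: R0 sub)
qed

section \<open>The Okounkov body\<close>

theorem proposition3p13:
  "okounkov_body complex_sphere (vector [0, 0, 1]) (\<lambda>z. vector [z $ 1, z $ 2]) =
     {\<theta> :: real ^ 2. 0 \<le> \<theta> $ 1 \<and> 0 \<le> \<theta> $ 2 \<and> \<theta> $ 1 + 2 * \<theta> $ 2 \<le> 2}"
  (is "?L = ?T")
proof
  have "convex ?T"
  proof (rule convexI)
    fix \<theta> \<eta> :: "real ^ 2" and u v :: real
    assume t: "\<theta> \<in> ?T" "\<eta> \<in> ?T" and uv: "0 \<le> u" "0 \<le> v" "u + v = 1"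
    have "u * (\<theta> $ 1 + 2 * \<theta> $ 2) + v * (\<eta> $ 1 + 2 * \<eta> $ 2) \<le> u * 2 + v * 2"
      using t uv by (intro add_mono mult_left_mono) auto
    also have "u * 2 + v * 2 = 2" using uv by simp
    finally have "u * \<theta> $ 1 + v * \<eta> $ 1 + 2 * (u * \<theta> $ 2 + v * \<eta> $ 2) \<le> 2"
      by (simp add: algebra_simps)
    thus "u *\<^sub>R \<theta> + v *\<^sub>R \<eta> \<in> ?T"
      using t uv by simp
  qed
  have "(1 / real k) *\<^sub>R (\<chi> i. real (\<alpha> $ i)) \<in> ?T"
    if k: "k \<ge> 1" and \<alpha>: "\<alpha> \<in> valuation_set complex_sphere pole coords k" for k \<alpha>
  proof -
    have "real (\<alpha> $ 1) + 2 * real (\<alpha> $ 2) \<le> 2 * real k"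
      using valuation_set_bound[OF \<alpha>] by linarith
    thus ?thesis using k by (simp add: field_simps)
  qed
  thus "?L \<subseteq> ?T"
    unfolding okounkov_body_def Delta_def
    by (intro hull_minimal \<open>convex ?T\<close> UN_least) auto
next
  have vertex: "(\<chi> i. real (\<alpha> $ i)) \<in> ?L"
    if "\<alpha> \<in> valuation_set complex_sphere pole coords 1" for \<alpha>
  proof -
    have "(\<chi> i. real (\<alpha> $ i)) \<in> Delta complex_sphere pole coords 1"
      unfolding Delta_def by (rule hull_inc) (use that in auto)
    thus ?thesis unfolding okounkov_body_def by (intro hull_inc) auto
  qed
  have "convex ?L" by (simp add: okounkov_body_def)
  show "?T \<subseteq> ?L"
  proof
    fix \<theta> assume \<theta>: "\<theta> \<in> ?T"
    let ?v = "\<lambda>a b. (\<chi> i. real ((vector [a, b] :: nat ^ 2) $ i)) :: real ^ 2"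
    have "{?v 0 0, ?v 2 0, ?v 0 1} \<subseteq> ?L"
      using vertices_in_valuation_set by (auto intro!: vertex)
    hence sub: "convex hull {?v 0 0, ?v 2 0, ?v 0 1} \<subseteq> ?L"
      using \<open>convex ?L\<close> by (rule hull_minimal)
    have comb: "\<theta> = (1 - \<theta> $ 1 / 2 - \<theta> $ 2) *\<^sub>R ?v 0 0 + (\<theta> $ 1 / 2) *\<^sub>R ?v 2 0 + (\<theta> $ 2) *\<^sub>R ?v 0 1"
      by (simp add: vec_eq_iff forall_2)
    have "\<theta> \<in> convex hull {?v 0 0, ?v 2 0, ?v 0 1}"
      unfolding convex_hull_3
      by (rule CollectI, rule exI[of _ "1 - \<theta> $ 1 / 2 - \<theta> $ 2"],
          rule exI[of _ "\<theta> $ 1 / 2"], rule exI[of _ "\<theta> $ 2"])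
         (use \<theta> comb in auto)
    with sub show "\<theta> \<in> ?L" by blast
  qed
qed

end
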